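(* Consider $n$ nodes placed at the integer points $1, \ldots, n$ of the real line, and let $b \ge 2$ be an integer. Let each node have links (number of links $O(\log_b n)$) to the nodes at distances $b^0, b^1, b^2, \ldots, b^{\lfloor \log_b n\rfloor}$. Assume the links to the nearest neighbors are always present, and that each other link is present independently with probability $p$. Messages are routed greedily along present links, each node forwarding the message to its neighbor closest to the target. Then the (expected) delivery time is $T(n) = O(b H_n / p)$.
   Context: $H_n = \sum_{i=1}^n 1/i$ is the $n$-th harmonic number. The delivery time is the number of hops taken to route a message from a source to a target node. *)

theory Defs
  imports "HOL-Probability.Probability" "HOL-Probability.Product_PMF"
begin

text \<open>Links are directed pairs \<open>(u, v)\<close>: each node owns links in both directions along the line,
  as far as the endpoints stay in \<open>{1..n}\<close>.\<close>

definition links :: "nat \<Rightarrow> nat \<Rightarrow> (int \<times> int) set" where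
  "links n b = {(u, v). u \<in> {1..int n} \<and> v \<in> {1..int n} \<and>
     (\<exists>i \<le> nat \<lfloor>log (real b) (real n)\<rfloor>. \<bar>u - v\<bar> = int b ^ i)}"

definition long_links :: "nat \<Rightarrow> nat \<Rightarrow> (int \<times> int) set" where
  "long_links n b = {(u, v) \<in> links n b. \<bar>u - v\<bar> \<noteq> 1}"

text \<open>The outcome \<open>\<omega>\<close> says which of the long links are present.\<close>

definition random_links :: "nat \<Rightarrow> nat \<Rightarrow> real \<Rightarrow> (int \<times> int \<Rightarrow> bool) pmf" where
  "random_links n b p = Pi_pmf (long_links n b) False (\<lambda>_. bernoulli_pmf p)"

definition neighbours :: "nat \<Rightarrow> nat \<Rightarrow> (int \<times> int \<Rightarrow> bool) \<Rightarrow> int \<Rightarrow> int set" where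
  "neighbours n b \<omega> u = {v. (u, v) \<in> links n b \<and> (\<bar>u - v\<bar> = 1 \<or> \<omega> (u, v))}"

text \<open>A rule \<open>R t u N\<close> gives the node to which \<open>u\<close>, with present neighbours \<open>N\<close>, forwards a message
  for the target \<open>t\<close>. Two neighbours on either side of \<open>t\<close> can be equally close to it; a greedy rule
  may break such ties in any way that depends only on \<open>t\<close>, \<open>u\<close> and \<open>N\<close>.\<close>

definition greedy_rule :: "(int \<Rightarrow> int \<Rightarrow> int set \<Rightarrow> int) \<Rightarrow> bool" where
  "greedy_rule R \<longleftrightarrow> (\<forall>t u N. finite N \<longrightarrow> N \<noteq> {} \<longrightarrow>
     R t u N \<in> N \<and> (\<forall>v \<in> N. \<bar>R t u N - t\<bar> \<le> \<bar>v - t\<bar>))"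

definition hop :: "nat \<Rightarrow> nat \<Rightarrow> (int \<Rightarrow> int \<Rightarrow> int set \<Rightarrow> int) \<Rightarrow> int \<Rightarrow> (int \<times> int \<Rightarrow> bool) \<Rightarrow> int \<Rightarrow> int"
  where "hop n b R t \<omega> u = R t u (neighbours n b \<omega> u)"

text \<open>The infimum is \<open>\<infinity>\<close> if the message never reaches the target.\<close>

definition delivery_time ::
    "nat \<Rightarrow> nat \<Rightarrow> (int \<Rightarrow> int \<Rightarrow> int set \<Rightarrow> int) \<Rightarrow> int \<Rightarrow> int \<Rightarrow> (int \<times> int \<Rightarrow> bool) \<Rightarrow> enat" where
  "delivery_time n b R s t \<omega> = (INF k \<in> {k. (hop n b R t \<omega> ^^ k) s = t}. enat k)"

definition expected_delivery_time ::
    "nat \<Rightarrow> nat \<Rightarrow> real \<Rightarrow> (int \<Rightarrow> int \<Rightarrow> int set \<Rightarrow> int) \<Rightarrow> int \<Rightarrow> int \<Rightarrow> ennreal" where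
  "expected_delivery_time n b p R s t =
     (\<integral>\<^sup>+ \<omega>. ennreal_of_enat (delivery_time n b R s t \<omega>) \<partial>measure_pmf (random_links n b p))"

lemma finite_long_links: "finite (long_links n b)"
proof (rule finite_subset)
  show "long_links n b \<subseteq> {1..int n} \<times> {1..int n}"
    by (auto simp: long_links_def links_def)
qed simp

lemma card_links_of_node: "card {v. (u, v) \<in> links n b} \<le> 2 * (nat \<lfloor>log (real b) (real n)\<rfloor> + 1)"
proof -
  let ?L = "nat \<lfloor>log (real b) (real n)\<rfloor>"
  let ?A = "(\<lambda>i. u + int b ^ i) ` {..?L}" and ?B = "(\<lambda>i. u - int b ^ i) ` {..?L}"
  have "{v. (u, v) \<in> links n b} \<subseteq> ?A \<union> ?B"
  proof
    fix v assume "v \<in> {v. (u, v) \<in> links n b}"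
    then obtain i where i: "i \<le> ?L" "\<bar>u - v\<bar> = int b ^ i" by (auto simp: links_def)
    then have "v = u + int b ^ i \<or> v = u - int b ^ i" by linarith
    with i(1) show "v \<in> ?A \<union> ?B" by blast
  qed
  then have "card {v. (u, v) \<in> links n b} \<le> card (?A \<union> ?B)" by (intro card_mono) auto
  also have "\<dots> \<le> card ?A + card ?B" by (rule card_Un_le)
  also have "\<dots> \<le> card {..?L} + card {..?L}" by (intro add_mono card_image_le) auto
  finally show ?thesis by simp
qed

lemma greedy_rule_exists: "\<exists>R. greedy_rule R"
proof -
  have "greedy_rule (\<lambda>t u N. arg_min_on (\<lambda>v. \<bar>v - t\<bar>) N)"
    unfolding greedy_rule_def using arg_min_if_finite(1) arg_min_least by metis
  then show ?thesis by blast
qed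

end

theory Submission
  imports Defs "HOL-Library.Log_Nat"
begin

text \<open>
  Put \<open>d = \<bar>u - t\<bar>\<close> and use the potential \<open>b H\<^sub>d\<close>. From a node \<open>u\<close> at distance
  \<open>b\<^sup>k \<le> d < b\<^sup>k\<^sup>+\<^sup>1\<close>, the link of length \<open>b\<^sup>k\<close> towards \<open>t\<close>, if present, makes the potential drop
  by at least \<open>b \<cdot> b\<^sup>k / d \<ge> 1\<close>; hence on every route at most \<open>b H\<^sub>n\<close> visited nodes have this link.
  Whether \<open>u\<close> is visited does not depend on the links owned by \<open>u\<close>, so a visited node has the link
  with probability at least \<open>p\<close>. Therefore \<open>p\<close> times the expected number of visited nodes is at most
  \<open>b H\<^sub>n\<close>.
\<close>

section \<open>Orbits descending to a target\<close>

text \<open>The clause over all \<open>i \<le> j\<close> confines the orbit to the steps before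
  \<open>t\<close> is first reached, since the total map \<open>f\<close> may move on from
  \<open>t\<close>.\<close>

definition visits_before :: "('a \<Rightarrow> 'a) \<Rightarrow> 'a \<Rightarrow> 'a \<Rightarrow> 'a \<Rightarrow> bool" where
  "visits_before f t s u \<longleftrightarrow> (\<exists>j. (f ^^ j) s = u \<and> (\<forall>i\<le>j. (f ^^ i) s \<noteq> t))"

text \<open>The value of the map at \<open>u\<close> only matters after \<open>u\<close> has been
  reached. This is the source of the independence between visiting \<open>u\<close> and the links
  owned by \<open>u\<close>.\<close>

lemma visits_before_cong:
  assumes fg: "\<And>x. x \<noteq> u \<Longrightarrow> f x = g x" and "visits_before f t s u"
  shows "visits_before g t s u"
proof -
  obtain j0 where j0: "(f ^^ j0) s = u" "\<forall>i\<le>j0. (f ^^ i) s \<noteq> t"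
    using assms(2) unfolding visits_before_def by blast
  \<comment> \<open>Up to the first visit to \<open>u\<close> the orbit avoids \<open>u\<close>, so
    there the orbits of \<open>f\<close> and \<open>g\<close> coincide.\<close>
  define j where "j = (LEAST j. (f ^^ j) s = u)"
  have j: "(f ^^ j) s = u" unfolding j_def using j0(1) by (rule LeastI)
  have least: "(f ^^ i) s \<noteq> u" if "i < j" for i
    using that not_less_Least unfolding j_def by blast
  have "j \<le> j0" unfolding j_def by (rule Least_le[of _ j0]) (rule j0(1))
  have eq: "(g ^^ i) s = (f ^^ i) s" if "i \<le> j" for i
    using that by (induction i) (auto simp: fg least)
  show ?thesis unfolding visits_before_def
    using j eq j0(2) \<open>j \<le> j0\<close> by (intro exI[of _ j]) auto
qed

text \<open>The strict descent of \<open>d\<close> forces the orbit to reach \<open>t\<close> and to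
  repeat no node on the way. The hitting time \<open>T\<close> thus becomes a number of visited
  nodes, whose expectation splits over the nodes.\<close>

lemma first_hit:
  fixes d :: "'a \<Rightarrow> nat"
  assumes "s \<in> V"
    and closed: "\<And>x. x \<in> V \<Longrightarrow> x \<noteq> t \<Longrightarrow> f x \<in> V"
    and decr: "\<And>x. x \<in> V \<Longrightarrow> x \<noteq> t \<Longrightarrow> d (f x) < d x"
  obtains T where "(f ^^ T) s = t" "inj_on (\<lambda>j. (f ^^ j) s) {..<T}"
    "(\<lambda>j. (f ^^ j) s) ` {..<T} = {u. visits_before f t s u}"
    "\<forall>j<T. (f ^^ j) s \<in> V - {t}"
proof -
  have ex: "\<exists>k. (f ^^ k) s = t"
  proof (rule ccontr)
    assume "\<nexists>k. (f ^^ k) s = t"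
    then have ne: "(f ^^ k) s \<noteq> t" for k by blast
    have V: "(f ^^ k) s \<in> V" for k
      by (induction k) (use assms(1) closed ne in auto)
    have "d ((f ^^ k) s) + k \<le> d s" for k
    proof (induction k)
      case (Suc k)
      then show ?case using decr[OF V[of k] ne[of k]] by simp
    qed simp
    from this[of "Suc (d s)"] show False by simp
  qed
  define T where "T = (LEAST k. (f ^^ k) s = t)"
  have T: "(f ^^ T) s = t" unfolding T_def using ex by (rule LeastI_ex)
  have ne: "(f ^^ k) s \<noteq> t" if "k < T" for k
    using that not_less_Least unfolding T_def by blast
  have V: "(f ^^ k) s \<in> V" if "k \<le> T" for k
    using that by (induction k) (use assms(1) closed ne in auto)
  have strict: "d ((f ^^ j) s) < d ((f ^^ i) s)" if "i < j" "j < T" for i j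
    using that
  proof (induction j)
    case (Suc j)
    have "d ((f ^^ Suc j) s) < d ((f ^^ j) s)"
      using decr[of "(f ^^ j) s"] V[of j] ne[of j] Suc.prems by simp
    with Suc show ?case by (cases "i = j") (auto intro: less_trans)
  qed simp
  show thesis
  proof
    show "inj_on (\<lambda>j. (f ^^ j) s) {..<T}"
    proof (rule inj_onI)
      fix i j assume "i \<in> {..<T}" "j \<in> {..<T}" "(f ^^ i) s = (f ^^ j) s"
      then show "i = j" using strict[of i j] strict[of j i]
        by (metis lessThan_iff less_irrefl linorder_neqE_nat)
    qed
    show "(\<lambda>j. (f ^^ j) s) ` {..<T} = {u. visits_before f t s u}"
    proof (intro equalityI subsetI)
      fix u assume "u \<in> (\<lambda>j. (f ^^ j) s) ` {..<T}"
      then show "u \<in> {u. visits_before f t s u}"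
        using ne unfolding visits_before_def by (auto intro: le_less_trans)
    next
      fix u assume "u \<in> {u. visits_before f t s u}"
      then obtain j where "(f ^^ j) s = u" "\<forall>i\<le>j. (f ^^ i) s \<noteq> t"
        unfolding visits_before_def by blast
      moreover from this have "j < T" using T not_le by blast
      ultimately show "u \<in> (\<lambda>j. (f ^^ j) s) ` {..<T}" by blast
    qed
  qed (use T ne V in auto)
qed

section \<open>Independence from one random link\<close>

text \<open>By \<open>inv\<close> the event \<open>P\<close> ignores the coordinate
  \<open>e\<close>; splitting that coordinate off as an independent Bernoulli factor yields the
  factor \<open>p\<close>.\<close>

lemma emeasure_Pi_bernoulli_coordinate:
  assumes "finite A" "e \<in> A" "0 \<le> p" "p \<le> 1"
    and inv: "\<And>f y. P (f(e := y)) = P f"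
  shows "emeasure (measure_pmf (Pi_pmf A d (\<lambda>_. bernoulli_pmf p))) {\<omega>. P \<omega> \<and> \<omega> e}
       = ennreal p * emeasure (measure_pmf (Pi_pmf A d (\<lambda>_. bernoulli_pmf p))) {\<omega>. P \<omega>}"
proof -
  let ?B = "bernoulli_pmf p" and ?Q = "Pi_pmf (A - {e}) d (\<lambda>_. bernoulli_pmf p)"
  have "Pi_pmf (insert e (A - {e})) d (\<lambda>_. ?B)
      = map_pmf (\<lambda>(y, f). f(e := y)) (pair_pmf ?B ?Q)"
    using assms by (intro Pi_pmf_insert) auto
  then have Pi: "Pi_pmf A d (\<lambda>_. ?B) = map_pmf (\<lambda>(y, f). f(e := y)) (pair_pmf ?B ?Q)"
    using assms(2) by (simp add: insert_absorb)
  have em: "emeasure (measure_pmf M) S = (\<integral>\<^sup>+ f. indicator S f \<partial>M)" for M and S :: "('a \<Rightarrow> bool) set"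
    by simp
  have "emeasure (measure_pmf (Pi_pmf A d (\<lambda>_. ?B))) {\<omega>. P \<omega> \<and> \<omega> e}
      = (\<integral>\<^sup>+ y. (\<integral>\<^sup>+ f. indicator {f. P f} f * indicator {True} y \<partial>?Q) \<partial>?B)"
    unfolding Pi em
    by (auto simp: nn_integral_pair_pmf' inv indicator_def intro!: nn_integral_cong)
  also have "\<dots> = ennreal p * emeasure (measure_pmf ?Q) {f. P f}"
    using assms by (simp add: nn_integral_multc nn_integral_cmult emeasure_pmf_single mult.commute)
  \<comment> \<open>Averaging over a coordinate that \<open>P\<close> ignores changes nothing, so
    the reduced and the full product give \<open>P\<close> the same mass.\<close>
  also have "emeasure (measure_pmf ?Q) {f. P f}
      = emeasure (measure_pmf (Pi_pmf A d (\<lambda>_. ?B))) {\<omega>. P \<omega>}"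
    unfolding Pi em
    by (simp add: nn_integral_pair_pmf' inv indicator_def[abs_def] del: nn_integral_indicator)
  finally show ?thesis .
qed

section \<open>Harmonic decrease and progress of one hop\<close>

text \<open>The difference consists of \<open>m\<close> terms, each at least
  \<open>1 / d\<close>.\<close>

lemma harm_diff_ge:
  assumes "m \<le> d"
  shows "real m / real d \<le> harm d - harm (d - m)"
proof -
  have "real m / real d = (\<Sum>i\<in>{d - m<..d}. inverse (real d))"
    using assms by (simp add: divide_inverse)
  also have "\<dots> \<le> (\<Sum>i\<in>{d - m<..d}. inverse (real i))"
    by (intro sum_mono le_imp_inverse_le) auto
  also have "\<dots> = harm d - harm (d - m)"
  proof -
    have "{1..d} = {1..d - m} \<union> {d - m<..d}" using assms by auto
    then have "harm d = harm (d - m) + (\<Sum>i\<in>{d - m<..d}. inverse (real i))"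
      unfolding harm_def by (subst sum.union_disjoint[symmetric]) auto
    then show ?thesis by simp
  qed
  finally show ?thesis .
qed

text \<open>Take \<open>m\<close> to be the largest power of \<open>b\<close> not exceeding the
  distance: the link does not overshoot \<open>t\<close>, and it covers at least the fraction
  \<open>1 / b\<close> of the distance.\<close>

lemma link_towards_target:
  assumes "b \<ge> 2" "u \<in> {1..int n}" "t \<in> {1..int n}" "u \<noteq> t"
  obtains v m where "(u, v) \<in> links n b" "m \<le> nat \<bar>u - t\<bar>" "nat \<bar>u - t\<bar> \<le> b * m"
    "nat \<bar>v - t\<bar> = nat \<bar>u - t\<bar> - m"
proof -
  let ?d = "nat \<bar>u - t\<bar>"
  have "?d \<ge> 1" "?d \<le> n" using assms by auto
  obtain k where k: "b ^ k \<le> ?d" "?d < b ^ (k + 1)"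
    using ex_power_ivl1[of b ?d] assms(1) \<open>?d \<ge> 1\<close> by auto
  \<comment> \<open>From \<open>b ^ k \<le> ?d \<le> n\<close> the exponent \<open>k\<close> is
    among those for which links exist.\<close>
  have "real b ^ k \<le> real n"
    using k(1) \<open>?d \<le> n\<close> by (metis le_trans of_nat_le_iff of_nat_power)
  then have "real k \<le> log (real b) (real n)"
    using assms(1) by (intro le_log_of_power) auto
  then have kL: "k \<le> nat \<lfloor>log (real b) (real n)\<rfloor>" by linarith
  define m where "m = b ^ k"
  define v where "v = (if u < t then u + int m else u - int m)"
  have m: "m \<le> ?d" "int m = int b ^ k" using k(1) by (auto simp: m_def)
  \<comment> \<open>As \<open>m \<le> ?d\<close>, the node \<open>v\<close> lies between
    \<open>u\<close> and \<open>t\<close>.\<close>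
  have "v \<in> {1..int n}" using assms m(1) by (auto simp: v_def)
  moreover have "\<bar>u - v\<bar> = int b ^ k" using m(2) by (auto simp: v_def)
  ultimately have "(u, v) \<in> links n b" using assms kL unfolding links_def by blast
  moreover have "nat \<bar>v - t\<bar> = ?d - m" using m(1) assms(4) by (auto simp: v_def)
  ultimately show thesis using that[of v m] m(1) k(2) by (simp add: m_def)
qed

lemma finite_neighbours: "finite (neighbours n b \<omega> u)"
  by (rule finite_subset[of _ "{1..int n}"]) (auto simp: neighbours_def links_def)

lemma
  assumes "greedy_rule R" "u \<in> {1..int n}" "t \<in> {1..int n}" "u \<noteq> t"
  shows hop_in_range: "hop n b R t \<omega> u \<in> {1..int n}"
    and hop_closer: "nat \<bar>hop n b R t \<omega> u - t\<bar> < nat \<bar>u - t\<bar>"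
    and hop_closest: "v \<in> neighbours n b \<omega> u \<Longrightarrow> nat \<bar>hop n b R t \<omega> u - t\<bar> \<le> nat \<bar>v - t\<bar>"
proof -
  let ?N = "neighbours n b \<omega> u"
  \<comment> \<open>The nearest neighbour towards \<open>t\<close> is always present and one step
    closer, so the greedy choice is closer as well.\<close>
  define w where "w = (if u < t then u + 1 else u - 1)"
  have "w \<in> {1..int n}" "\<bar>u - w\<bar> = int b ^ 0" using assms by (auto simp: w_def)
  then have w: "w \<in> ?N" using assms(2) unfolding neighbours_def links_def by fastforce
  have R: "hop n b R t \<omega> u \<in> ?N" "\<And>v. v \<in> ?N \<Longrightarrow> \<bar>hop n b R t \<omega> u - t\<bar> \<le> \<bar>v - t\<bar>"
    using assms(1) w finite_neighbours[of n b \<omega> u] unfolding greedy_rule_def hop_def by blast+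
  show "hop n b R t \<omega> u \<in> {1..int n}" using R(1) by (auto simp: neighbours_def links_def)
  show "nat \<bar>hop n b R t \<omega> u - t\<bar> < nat \<bar>u - t\<bar>"
    using R(2)[OF w] assms(4) by (auto simp: w_def split: if_splits)
  show "nat \<bar>hop n b R t \<omega> u - t\<bar> \<le> nat \<bar>v - t\<bar>" if "v \<in> ?N"
    using R(2)[OF that] by simp
qed

section \<open>Bounds on the route for a fixed outcome\<close>

text \<open>Both bounds hold for every single \<open>\<omega>\<close>. The first counts the hops by
  visited nodes; the second telescopes the potential \<open>?h\<close> along the route.\<close>

lemma route_bounds:
  fixes next_node :: "int \<Rightarrow> int"
  assumes "greedy_rule R" "s \<in> {1..int n}" "t \<in> {1..int n}"
    and link: "\<And>u. u \<in> {1..int n} - {t} \<Longrightarrow> \<exists>m \<le> nat \<bar>u - t\<bar>. nat \<bar>u - t\<bar> \<le> b * m \<and>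
        nat \<bar>next_node u - t\<bar> = nat \<bar>u - t\<bar> - m"
  defines "visited \<equiv> \<lambda>\<omega> u. visits_before (hop n b R t \<omega>) t s u"
  shows delivery_time_le_card_visited:
      "delivery_time n b R s t \<omega> \<le> enat (card {u \<in> {1..int n} - {t}. visited \<omega> u})"
    and card_visited_with_link_le:
      "real (card {u \<in> {1..int n} - {t}. visited \<omega> u \<and> next_node u \<in> neighbours n b \<omega> u})
        \<le> real b * harm n"
proof -
  let ?f = "hop n b R t \<omega>" and ?d = "\<lambda>u. nat \<bar>u - t\<bar>" and ?V = "{1..int n}"
  let ?h = "\<lambda>u. real b * harm (?d u)"
  let ?X = "\<lambda>u. next_node u \<in> neighbours n b \<omega> u"
  obtain T where T: "(?f ^^ T) s = t" "inj_on (\<lambda>j. (?f ^^ j) s) {..<T}"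
    "(\<lambda>j. (?f ^^ j) s) ` {..<T} = {u. visited \<omega> u}"
    "\<forall>j<T. (?f ^^ j) s \<in> ?V - {t}"
    unfolding visited_def
    by (rule first_hit[of s ?V t ?f ?d, OF assms(2) hop_in_range[OF assms(1) _ assms(3)]
          hop_closer[OF assms(1) _ assms(3)]])
  have "u \<in> ?V - {t}" if "visited \<omega> u" for u
  proof -
    from that have "u \<in> (\<lambda>j. (?f ^^ j) s) ` {..<T}" unfolding T(3) ..
    then obtain j where "j < T" "u = (?f ^^ j) s" by (elim imageE) simp
    then show ?thesis using T(4) by metis
  qed
  then have vis: "{u \<in> ?V - {t}. visited \<omega> u} = (\<lambda>j. (?f ^^ j) s) ` {..<T}"
    unfolding T(3) by blast
  then have "card {u \<in> ?V - {t}. visited \<omega> u} = T" using T(2) by (simp add: card_image)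
  then show "delivery_time n b R s t \<omega> \<le> enat (card {u \<in> ?V - {t}. visited \<omega> u})"
    unfolding delivery_time_def using T(1) by (auto intro: INF_lower)
  \<comment> \<open>One inequality for both cases: a drop of at least 1 if the link is present, and
    no increase otherwise.\<close>
  have drop: "of_bool (?X u) \<le> ?h u - ?h (?f u)" if u: "u \<in> ?V - {t}" for u
  proof (cases "?X u")
    case True
    from link[OF u] obtain m where m: "m \<le> ?d u" "?d u \<le> b * m" "?d (next_node u) = ?d u - m"
      by blast
    have "?d (?f u) \<le> ?d u - m"
      using hop_closest[OF assms(1) _ assms(3) _ True] u m(3) by auto
    then have "real b * harm (?d (?f u)) \<le> real b * harm (?d u - m)"
      by (intro mult_left_mono harm_mono) auto
    moreover have "1 \<le> real b * (real m / real (?d u))"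
    proof -
      have "real (?d u) \<le> real b * real m" using m(2) by (metis of_nat_le_iff of_nat_mult)
      moreover have "real (?d u) > 0" using u by auto
      ultimately show ?thesis by (simp add: field_simps)
    qed
    moreover have "real b * (real m / real (?d u)) \<le> real b * (harm (?d u) - harm (?d u - m))"
      by (intro mult_left_mono harm_diff_ge m) auto
    ultimately show ?thesis using True by (simp add: algebra_simps)
  next
    case False
    have "?d (?f u) \<le> ?d u" using hop_closer[OF assms(1) _ assms(3)] u by (simp add: less_imp_le)
    then have "real b * harm (?d (?f u)) \<le> real b * harm (?d u)"
      by (intro mult_left_mono harm_mono) auto
    with False show ?thesis by simp
  qed
  define W where "W = {u \<in> ?V - {t}. visited \<omega> u}"
  have "finite W" unfolding W_def vis by simp
  moreover have "{u \<in> ?V - {t}. visited \<omega> u \<and> ?X u} = W \<inter> {u. ?X u}"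
    unfolding W_def by auto
  ultimately have "real (card {u \<in> ?V - {t}. visited \<omega> u \<and> ?X u}) = (\<Sum>u\<in>W. of_bool (?X u))"
    by (simp add: sum_of_bool_eq)
  \<comment> \<open>Indexing the visited nodes by time makes the potential differences
    telescope.\<close>
  also have "\<dots> = (\<Sum>j<T. of_bool (?X ((?f ^^ j) s)))"
    unfolding W_def vis sum.reindex[OF T(2)] comp_def ..
  also have "\<dots> \<le> (\<Sum>j<T. ?h ((?f ^^ j) s) - ?h ((?f ^^ Suc j) s))"
    using T(4) drop by (intro sum_mono) auto
  also have "\<dots> = ?h s - ?h t"
    using sum_lessThan_telescope'[of "\<lambda>j. ?h ((?f ^^ j) s)" T] T(1) by simp
  \<comment> \<open>The potential vanishes at \<open>t\<close>, and the distance from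
    \<open>s\<close> to \<open>t\<close> is at most \<open>n\<close>.\<close>
  also have "\<dots> \<le> real b * harm n"
    using assms(2,3) by (auto simp: harm_def intro!: mult_left_mono sum_mono2)
  finally show "real (card {u \<in> ?V - {t}. visited \<omega> u \<and> ?X u}) \<le> real b * harm n" .
qed

section \<open>Passing to expectations\<close>

lemma nn_integral_card_eq_sum_emeasure:
  assumes "finite V"
  shows "(\<integral>\<^sup>+ \<omega>. of_nat (card {u \<in> V. P \<omega> u}) \<partial>measure_pmf M)
    = (\<Sum>u\<in>V. emeasure (measure_pmf M) {\<omega>. P \<omega> u})"
proof -
  have "of_nat (card {u \<in> V. P \<omega> u}) = (\<Sum>u\<in>V. indicator {\<omega>. P \<omega> u} \<omega> :: ennreal)" for \<omega>
  proof -
    have "{u \<in> V. P \<omega> u} = V \<inter> {u. P \<omega> u}" by blast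
    then show ?thesis using assms by (simp add: indicator_def sum_of_bool_eq)
  qed
  then show ?thesis by (simp add: nn_integral_sum)
qed

lemma hop_fun_upd_other:
  "x \<noteq> u \<Longrightarrow> hop n b R t (fun_upd \<omega> (u, v) y) x = hop n b R t \<omega> x"
  by (simp add: hop_def neighbours_def)

text \<open>A long link is present with probability \<open>p\<close> independently of the visit to
  its owner; a nearest-neighbour link is always present, whence only an inequality.\<close>

lemma prob_visited_le:
  fixes R :: "int \<Rightarrow> int \<Rightarrow> int set \<Rightarrow> int" and s t :: int
  assumes "0 < p" "p \<le> 1" "(u, v) \<in> links n b"
  defines "visited \<equiv> \<lambda>\<omega>. visits_before (hop n b R t \<omega>) t s u"
  shows "ennreal p * emeasure (measure_pmf (random_links n b p)) {\<omega>. visited \<omega>}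
    \<le> emeasure (measure_pmf (random_links n b p)) {\<omega>. visited \<omega> \<and> v \<in> neighbours n b \<omega> u}"
proof (cases "\<bar>u - v\<bar> = 1")
  case True
  then have "{\<omega>. visited \<omega> \<and> v \<in> neighbours n b \<omega> u} = {\<omega>. visited \<omega>}"
    using assms(3) by (auto simp: neighbours_def)
  moreover have "ennreal p * c \<le> c" for c
    using mult_right_mono[of "ennreal p" 1 c] assms(2) by (simp add: ennreal_le_1)
  ultimately show ?thesis by simp
next
  case False
  then have e: "(u, v) \<in> long_links n b" using assms(3) by (auto simp: long_links_def)
  \<comment> \<open>Links are directed, so changing the bit of \<open>(u, v)\<close> affects the hop
    at \<open>u\<close> alone.\<close>
  have "visited (fun_upd \<omega> (u, v) y) = visited \<omega>" for \<omega> y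
    unfolding visited_def
    by (intro iffI; erule visits_before_cong[rotated]) (simp_all add: hop_fun_upd_other)
  then have "emeasure (measure_pmf (random_links n b p)) {\<omega>. visited \<omega> \<and> \<omega> (u, v)}
      = ennreal p * emeasure (measure_pmf (random_links n b p)) {\<omega>. visited \<omega>}"
    unfolding random_links_def
    using emeasure_Pi_bernoulli_coordinate[OF finite_long_links e, of p visited] assms(1,2) by simp
  then show ?thesis using False assms(3) by (simp add: neighbours_def)
qed

lemma expected_delivery_time_le:
  assumes "b \<ge> 2" "0 < p" "p \<le> 1" "greedy_rule R" "s \<in> {1..int n}" "t \<in> {1..int n}"
  shows "expected_delivery_time n b p R s t \<le> ennreal (real b * harm n / p)"
proof -
  let ?M = "measure_pmf (random_links n b p)" and ?V = "{1..int n} - {t}"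
  let ?vis = "\<lambda>\<omega> u. visits_before (hop n b R t \<omega>) t s u"
  \<comment> \<open>One link per node is fixed before \<open>\<omega>\<close> is drawn, so that the
    probability estimate applies node by node.\<close>
  have "\<forall>u\<in>?V. \<exists>v. (u, v) \<in> links n b \<and> (\<exists>m \<le> nat \<bar>u - t\<bar>. nat \<bar>u - t\<bar> \<le> b * m \<and>
      nat \<bar>v - t\<bar> = nat \<bar>u - t\<bar> - m)"
    using link_towards_target[OF assms(1) _ assms(6)] by (metis DiffE singletonI)
  then obtain nx where nx: "\<And>u. u \<in> ?V \<Longrightarrow> (u, nx u) \<in> links n b"
    "\<And>u. u \<in> ?V \<Longrightarrow> \<exists>m \<le> nat \<bar>u - t\<bar>. nat \<bar>u - t\<bar> \<le> b * m \<and>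
      nat \<bar>nx u - t\<bar> = nat \<bar>u - t\<bar> - m"
    by metis
  note bounds = route_bounds[OF assms(4,5,6) nx(2)]
  have "expected_delivery_time n b p R s t \<le> (\<integral>\<^sup>+ \<omega>. of_nat (card {u \<in> ?V. ?vis \<omega> u}) \<partial>?M)"
    unfolding expected_delivery_time_def
    using ennreal_of_enat_le_iff[THEN iffD2, OF bounds(1)] by (intro nn_integral_mono) simp
  also have "\<dots> = (\<Sum>u\<in>?V. emeasure ?M {\<omega>. ?vis \<omega> u})"
    by (rule nn_integral_card_eq_sum_emeasure) simp
  finally have "ennreal p * expected_delivery_time n b p R s t
      \<le> ennreal p * (\<Sum>u\<in>?V. emeasure ?M {\<omega>. ?vis \<omega> u})"
    by (rule mult_left_mono) simp
  also have "\<dots> \<le> (\<Sum>u\<in>?V. emeasure ?M {\<omega>. ?vis \<omega> u \<and> nx u \<in> neighbours n b \<omega> u})"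
    unfolding sum_distrib_left by (intro sum_mono prob_visited_le assms nx)
  also have "\<dots> = (\<integral>\<^sup>+ \<omega>. of_nat (card {u \<in> ?V. ?vis \<omega> u \<and> nx u \<in> neighbours n b \<omega> u}) \<partial>?M)"
    by (rule nn_integral_card_eq_sum_emeasure[symmetric]) simp
  also have "\<dots> \<le> (\<integral>\<^sup>+ \<omega>. ennreal (real b * harm n) \<partial>?M)"
    using bounds(2) by (intro nn_integral_mono) (simp add: ennreal_of_nat_eq_real_of_nat ennreal_leI)
  also have "\<dots> = ennreal (real b * harm n)" by simp
  finally have "ennreal (1 / p) * (ennreal p * expected_delivery_time n b p R s t)
      \<le> ennreal (1 / p) * ennreal (real b * harm n)"
    by (rule mult_left_mono) simp
  \<comment> \<open>This cancels \<open>p\<close> for every \<open>c\<close>, including an infinite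
    one.\<close>
  moreover have "ennreal (1 / p) * (ennreal p * c) = c" for c
    using assms(2) by (simp add: mult.assoc[symmetric] ennreal_mult[symmetric])
  ultimately show ?thesis
    using assms(2) by (simp add: ennreal_mult'[symmetric])
qed

theorem theorem8:
  shows "\<exists>C::real. C > 0 \<and>
    (\<forall>(n::nat) (b::nat) (p::real) R s t.
       b \<ge> 2 \<longrightarrow> 0 < p \<longrightarrow> p \<le> 1 \<longrightarrow> greedy_rule R \<longrightarrow>
       s \<in> {1..int n} \<longrightarrow> t \<in> {1..int n} \<longrightarrow>
       expected_delivery_time n b p R s t \<le> ennreal (C * (real b * harm n / p)))"
  using expected_delivery_time_le by (intro exI[of _ 1]) simp

end
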